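(* Let $r\ge 3$ be a fixed integer. Then almost all $r$-regular graphs have proper connection number $2$; that is, the number of $r$-regular graphs on $n$ labeled vertices that are connected and have $pc(G)=2$, divided by the total number of $r$-regular graphs on these $n$ labeled vertices, tends to $1$ as $n\to\infty$ (through those $n$ for which $r$-regular graphs on $n$ vertices exist).
   Context: All graphs are finite, simple and undirected. In an edge-colored graph (adjacent edges may receive the same color), a path is proper if no two adjacent edges of the path have the same color. For a nontrivial connected graph $G$, the proper connection number $pc(G)$ is the minimum number of colors in an edge-coloring of $G$ such that every two distinct vertices of $G$ are connected by at least one proper path. *)

theory Defs
  imports Complex_Main
begin

text \<open>A finite simple undirected graph is a vertex set \<open>V\<close> together with a set \<open>E\<close> of
  two-element subsets of \<open>V\<close>.\<close>

definition simple_graph :: "'a set \<Rightarrow> 'a set set \<Rightarrow> bool" where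
  "simple_graph V E \<longleftrightarrow> finite V \<and> (\<forall>e\<in>E. e \<subseteq> V \<and> card e = 2)"

definition graph_degree :: "'a set set \<Rightarrow> 'a \<Rightarrow> nat" where
  "graph_degree E v = card {e \<in> E. v \<in> e}"

definition graph_path :: "'a set \<Rightarrow> 'a set set \<Rightarrow> 'a \<Rightarrow> 'a list \<Rightarrow> 'a \<Rightarrow> bool" where
  "graph_path V E u p v \<longleftrightarrow>
     p \<noteq> [] \<and> hd p = u \<and> last p = v \<and> set p \<subseteq> V \<and> distinct p \<and>
     (\<forall>i. Suc i < length p \<longrightarrow> {p ! i, p ! Suc i} \<in> E)"

definition graph_connected :: "'a set \<Rightarrow> 'a set set \<Rightarrow> bool" where
  "graph_connected V E \<longleftrightarrow> V \<noteq> {} \<and> (\<forall>u\<in>V. \<forall>v\<in>V. \<exists>p. graph_path V E u p v)"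

text \<open>The vertices of a path are distinct, so two of its edges are adjacent exactly when they
  are consecutive.\<close>

definition properly_colored :: "('a set \<Rightarrow> nat) \<Rightarrow> 'a list \<Rightarrow> bool" where
  "properly_colored c p \<longleftrightarrow>
     (\<forall>i. Suc (Suc i) < length p \<longrightarrow>
        c {p ! i, p ! Suc i} \<noteq> c {p ! Suc i, p ! Suc (Suc i)})"

definition proper_connected_coloring :: "'a set \<Rightarrow> 'a set set \<Rightarrow> ('a set \<Rightarrow> nat) \<Rightarrow> bool" where
  "proper_connected_coloring V E c \<longleftrightarrow>
     (\<forall>u\<in>V. \<forall>v\<in>V. u \<noteq> v \<longrightarrow> (\<exists>p. graph_path V E u p v \<and> properly_colored c p))"

text \<open>Only the values of \<open>c\<close> on \<open>E\<close> matter. The minimum is over a nonempty set if the graph is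
  finite and connected (give all edges different colors); for a disconnected graph the value
  is unspecified.\<close>

definition proper_connection_number :: "'a set \<Rightarrow> 'a set set \<Rightarrow> nat" where
  "proper_connection_number V E =
     (LEAST k. \<exists>c. proper_connected_coloring V E c \<and> card (c ` E) = k)"

text \<open>Labeled graphs on \<open>{..<n}\<close>, identified with their edge sets.\<close>

definition regular_graphs :: "nat \<Rightarrow> nat \<Rightarrow> nat set set set" where
  "regular_graphs r n =
     {E. simple_graph {..<n} E \<and> (\<forall>v<n. graph_degree E v = r)}"

end

theory Submission
  imports Defs "HOL-Analysis.Convex"
begin

text \<open>A 3-edge-connected graph has proper connection number at most 2: a maximum cut yields a
  spanning bipartite subgraph in which every cut keeps at least half of its edges, hence at least
  two. By Robbins' theorem this subgraph has a strong orientation. Color an arc according to the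
  side of the bipartition that it leaves; then consecutive arcs of a directed path have different
  colors, so all directed paths are proper.

  Almost all \<open>r\<close>-regular graphs are 3-edge-connected: for a fixed vertex set \<open>S\<close>, switching an
  edge inside \<open>S\<close> with an edge outside \<open>S\<close> raises the size of the cut by two, and double counting
  of switchings bounds the ratio of the numbers of graphs with cut sizes \<open>d\<close> and \<open>d + 2\<close>. Iterating
  this bound starting from \<open>d \<le> 2\<close> and summing over all \<open>S\<close> leaves a proportion \<open>O(1/n)\<close> of graphs
  with a cut of at most two edges.\<close>

subsection \<open>Strong orientations and proper paths\<close>

definition adj :: "'a set set \<Rightarrow> ('a \<times> 'a) set" where
  "adj E = {(x, y). {x, y} \<in> E}"

text \<open>On a symmetric relation each cut edge is counted twice. The result is again a relation,
  so \<open>crossing (crossing A X) S\<close> is the cut at \<open>S\<close> within the bipartite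
  subgraph given by \<open>X\<close>.\<close>

definition crossing :: "('a \<times> 'a) set \<Rightarrow> 'a set \<Rightarrow> ('a \<times> 'a) set" where
  "crossing A X = {(x, y) \<in> A. x \<in> X \<longleftrightarrow> y \<notin> X}"

lemma sym_adj: "sym (adj E)"
  by (auto simp: adj_def sym_def insert_commute)

lemma adj_subset: "simple_graph V E \<Longrightarrow> adj E \<subseteq> V \<times> V"
  by (auto simp: adj_def simple_graph_def)

lemma irrefl_adj: "simple_graph V E \<Longrightarrow> (x, x) \<notin> adj E"
  by (auto simp: adj_def simple_graph_def)

lemma finite_adj: "simple_graph V E \<Longrightarrow> finite (adj E)"
  by (rule finite_subset[OF adj_subset]) (auto simp: simple_graph_def)

lemma finite_edges: "simple_graph V E \<Longrightarrow> finite E"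
  by (rule finite_subset[of _ "Pow V"]) (auto simp: simple_graph_def)

lemma crossing_subset: "crossing A X \<subseteq> A"
  by (auto simp: crossing_def)

lemmas finite_crossing = finite_subset[OF crossing_subset]

lemma card_crossing:
  assumes "finite A" "sym A" "A \<subseteq> V \<times> V"
  shows "card (crossing A X) = 2 * card (A \<inter> X \<times> (V - X))"
proof -
  let ?C = "A \<inter> X \<times> (V - X)"
  have "crossing A X = ?C \<union> ?C\<inverse>"
    using assms(2,3) by (auto simp: crossing_def sym_def)
  moreover have "?C \<inter> ?C\<inverse> = {}" by auto
  ultimately have "card (crossing A X) = card ?C + card (?C\<inverse>)"
    using assms(1) by (simp add: card_Un_disjoint)
  then show ?thesis by simp
qed

text \<open>Moving \<open>S\<close> to the other side of a maximum cut replaces the cut by its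
  symmetric difference with the cut of \<open>S\<close>. This cannot gain arcs, so at most half of
  the arcs crossing \<open>S\<close> lie outside the maximum cut.\<close>

lemma max_cut:
  assumes "finite A"
  obtains X where "\<And>S. card (crossing A S) \<le> 2 * card (crossing (crossing A X) S)"
proof -
  have "\<exists>X. \<forall>Y. card (crossing A Y) \<le> card (crossing A X)"
    using ex_has_greatest_nat[of "\<lambda>_. True" _ "\<lambda>X. card (crossing A X)" "Suc (card A)"]
      card_mono[OF assms crossing_subset] by (auto simp: less_Suc_eq_le)
  then obtain X where X: "\<And>Y. card (crossing A Y) \<le> card (crossing A X)" by auto
  have "card (crossing A S) \<le> 2 * card (crossing (crossing A X) S)" for S
  proof -
    let ?C = "crossing A X" and ?D = "crossing A S"
    let ?Y = "(X - S) \<union> (S - X)"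
    have fin: "finite ?C" "finite ?D"
      using assms by (simp_all add: finite_crossing)
    have "crossing A ?Y = (?C - ?D) \<union> (?D - ?C)"
      by (auto simp: crossing_def)
    then have "card (?C - ?D) + card (?D - ?C) \<le> card ?C"
      using X[of ?Y] card_Un_disjoint[of "?C - ?D" "?D - ?C"] fin
      by (simp add: Diff_Int_distrib Int_Diff Diff_eq Int_ac)
    moreover have "card ?C = card (?C \<inter> ?D) + card (?C - ?D)"
      using fin by (metis card_Int_Diff)
    moreover have "card ?D = card (?C \<inter> ?D) + card (?D - ?C)"
      using fin by (metis card_Int_Diff inf_commute)
    moreover have "crossing ?C S = ?C \<inter> ?D" by (auto simp: crossing_def)
    ultimately show ?thesis by simp
  qed
  then show ?thesis using that by blast
qed

section \<open>Robbins' theorem\<close>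

lemma not_rtrancl_leaving_arc:
  assumes "(u, v) \<in> R\<^sup>*" "u \<in> S" "v \<notin> S"
  obtains x y where "(x, y) \<in> R" "x \<in> S" "y \<notin> S"
  using assms by (induction rule: rtrancl_induct) blast+

text \<open>Among the strongly connected arc sets that contain every edge in at least one direction,
  \<open>A\<close> itself being one, take one with the fewest arcs. Minimality leaves a single
  orientation of each edge.\<close>

lemma strong_orientation:
  assumes "finite A" and sym: "sym A" and irr: "\<And>x. (x, x) \<notin> A" and AV: "A \<subseteq> V \<times> V"
    and cut: "\<And>S. S \<noteq> {} \<Longrightarrow> S \<subset> V \<Longrightarrow> 2 \<le> card (A \<inter> S \<times> (V - S))"
  obtains R where "R \<union> R\<inverse> = A" "R \<inter> R\<inverse> = {}" "V \<times> V \<subseteq> R\<^sup>*"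
proof -
  let ?P = "\<lambda>R. R \<union> R\<inverse> = A \<and> V \<times> V \<subseteq> R\<^sup>*"
  have "V \<times> V \<subseteq> A\<^sup>*"
  proof clarify
    fix u v assume uv: "u \<in> V" "v \<in> V"
    show "(u, v) \<in> A\<^sup>*"
    proof (rule ccontr)
      assume n: "(u, v) \<notin> A\<^sup>*"
      \<comment> \<open>The reachable set would have an empty cut.\<close>
      let ?S = "A\<^sup>* `` {u}"
      have "?S \<subseteq> V"
        using AV uv by (auto elim: rtranclE)
      moreover have "A \<inter> ?S \<times> (V - ?S) = {}"
        by (auto intro: rtrancl_into_rtrancl)
      ultimately show False using cut[of ?S] n uv by auto
    qed
  qed
  moreover have "A \<union> A\<inverse> = A" using sym by (auto simp: sym_def)
  ultimately have "?P A" by simp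
  then obtain R where R: "?P R" and min: "\<And>R'. ?P R' \<Longrightarrow> card R \<le> card R'"
    using ex_has_least_nat[of ?P A card] by auto
  have RA: "R \<subseteq> A" and RV: "R \<subseteq> V \<times> V" using R AV by auto
  have finR: "finite R" using RA \<open>finite A\<close> finite_subset by blast
  text \<open>If both orientations of an edge were needed for strong connectivity, then the reach of
    each end avoiding that edge would be a set left by a single arc; uncrossing the two sets
    shows that they are complementary, so the edge would be a bridge.\<close>
  have reach: "\<exists>S. x \<in> S \<and> y \<notin> S \<and> (\<forall>a b. (a, b) \<in> R \<longrightarrow> a \<in> S \<longrightarrow> b \<notin> S \<longrightarrow> (a, b) = (x, y))"
    if xy: "(x, y) \<in> R" "(y, x) \<in> R" for x y
  proof -
    let ?R = "R - {(x, y)}"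
    have "x \<noteq> y" using irr xy RA by auto
    then have "?R \<union> ?R\<inverse> = A" using R xy by auto
    moreover have "card ?R < card R" using finR xy(1) by (rule card_Diff1_less)
    ultimately have "\<not> V \<times> V \<subseteq> ?R\<^sup>*" using min[of ?R] by auto
    \<comment> \<open>Otherwise a detour replaces the arc, and deleting it keeps strong connectivity
      while \<open>(y, x)\<close> still covers the edge, against minimality.\<close>
    have "(x, y) \<notin> ?R\<^sup>*"
    proof
      assume "(x, y) \<in> ?R\<^sup>*"
      then have "R \<subseteq> ?R\<^sup>*" by auto
      then have "R\<^sup>* \<subseteq> ?R\<^sup>*" by (simp add: rtrancl_subset_rtrancl)
      then show False using R \<open>\<not> V \<times> V \<subseteq> ?R\<^sup>*\<close> by auto
    qed
    then show ?thesis
      by (intro exI[of _ "?R\<^sup>* `` {x}"]) (auto intro: rtrancl_into_rtrancl)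
  qed
  have "R \<inter> R\<inverse> = {}"
  proof (rule ccontr)
    assume "R \<inter> R\<inverse> \<noteq> {}"
    then obtain u v where uv: "(u, v) \<in> R" "(v, u) \<in> R" by auto
    obtain S where S: "u \<in> S" "v \<notin> S" "\<And>a b. (a, b) \<in> R \<Longrightarrow> a \<in> S \<Longrightarrow> b \<notin> S \<Longrightarrow> (a, b) = (u, v)"
      using reach[OF uv] by blast
    obtain T where T: "v \<in> T" "u \<notin> T" "\<And>a b. (a, b) \<in> R \<Longrightarrow> a \<in> T \<Longrightarrow> b \<notin> T \<Longrightarrow> (a, b) = (v, u)"
      using reach[OF uv(2,1)] by blast
    have uvV: "u \<in> V" "v \<in> V" using uv RV by auto
    \<comment> \<open>An arc leaving the union leaves \<open>S\<close> or \<open>T\<close>, so it is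
      \<open>(u, v)\<close> or \<open>(v, u)\<close>; but both ends of these lie in the
      union.\<close>
    have cover: "x \<in> S \<union> T" if "x \<in> V" for x
    proof (rule ccontr)
      assume n: "x \<notin> S \<union> T"
      have "(u, x) \<in> R\<^sup>*" using R uvV that by auto
      then obtain a b where "(a, b) \<in> R" "a \<in> S \<union> T" "b \<notin> S \<union> T"
        using not_rtrancl_leaving_arc[of u x R "S \<union> T"] S(1) n by blast
      then show False using S T by blast
    qed
    \<comment> \<open>An arc leaving the intersection would have tail \<open>u\<close> or
      \<open>v\<close>, but \<open>u\<close> is not in \<open>T\<close> and \<open>v\<close> is not
      in \<open>S\<close>.\<close>
    have disj: "x \<notin> S \<inter> T" if "x \<in> V" for x
    proof
      assume n: "x \<in> S \<inter> T"
      have "(x, u) \<in> R\<^sup>*" using R uvV that by auto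
      then obtain a b where "(a, b) \<in> R" "a \<in> S \<inter> T" "b \<notin> S \<inter> T"
        using not_rtrancl_leaving_arc[of x u R "S \<inter> T"] T(2) n by blast
      then show False using S T by blast
    qed
    let ?S = "S \<inter> V"
    have "A \<inter> ?S \<times> (V - ?S) \<subseteq> {(u, v)}"
    proof (rule subrelI)
      fix a b assume "(a, b) \<in> A \<inter> ?S \<times> (V - ?S)"
      then have ab: "(a, b) \<in> A" "a \<in> S" "a \<in> V" "b \<in> V" "b \<notin> S" by auto
      \<comment> \<open>A cut edge oriented into \<open>S\<close> leaves \<open>T\<close>, the
        complement of \<open>S\<close> in \<open>V\<close>, so it is \<open>(v, u)\<close>. Either
        way the cut consists of one edge.\<close>
      then consider "(a, b) \<in> R" | "(b, a) \<in> R" using R by auto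
      then show "(a, b) \<in> {(u, v)}"
      proof cases
        case 1
        then show ?thesis using S(3)[of a b] ab by auto
      next
        case 2
        then show ?thesis using T(3)[of b a] cover[of b] disj[of a] ab by auto
      qed
    qed
    then have "card (A \<inter> ?S \<times> (V - ?S)) \<le> 1"
      using card_mono[of "{(u, v)}"] by fastforce
    moreover have "?S \<noteq> {}" "?S \<subset> V" using S uvV by auto
    ultimately show False using cut[of ?S] by auto
  qed
  then show ?thesis using that R by blast
qed

section \<open>From directed paths to proper paths\<close>

lemma rtrancl_imp_distinct_path:
  assumes "(u, v) \<in> R\<^sup>*"
  shows "\<exists>p. p \<noteq> [] \<and> hd p = u \<and> last p = v \<and> distinct p \<and> set p \<subseteq> insert u (Range R) \<and>
             successively (\<lambda>x y. (x, y) \<in> R) p"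
  using assms
proof (induction rule: converse_rtrancl_induct)
  case base
  show ?case by (intro exI[of _ "[v]"]) auto
next
  case (step u w)
  then obtain p where p: "p \<noteq> []" "hd p = w" "last p = v" "distinct p"
    "set p \<subseteq> insert w (Range R)" "successively (\<lambda>x y. (x, y) \<in> R) p" by blast
  show ?case
  \<comment> \<open>If the new start already occurs, the path is cut back to that
    occurrence.\<close>
  proof (cases "u \<in> set p")
    case True
    then obtain xs ys where "p = xs @ u # ys" by (meson split_list)
    then show ?thesis using p step(1)
      by (intro exI[of _ "u # ys"]) (auto simp: successively_append_iff)
  next
    case False
    then show ?thesis using p step(1)
      by (intro exI[of _ "u # p"]) (auto simp: successively_Cons)
  qed
qed

lemma three_edge_connected_coloring:
  assumes G: "simple_graph V E"
    and cut: "\<And>S. S \<noteq> {} \<Longrightarrow> S \<subset> V \<Longrightarrow> 3 \<le> card (adj E \<inter> S \<times> (V - S))"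
  obtains c where "proper_connected_coloring V E c" "range c \<subseteq> {0, 1}"
proof -
  let ?A = "adj E"
  have fin: "finite ?A" by (rule finite_adj[OF G])
  obtain X where X: "\<And>S. card (crossing ?A S) \<le> 2 * card (crossing (crossing ?A X) S)"
    using max_cut[OF fin] by blast
  let ?B = "crossing ?A X"
  have B: "finite ?B" "sym ?B" "?B \<subseteq> V \<times> V" "\<And>x. (x, x) \<notin> ?B"
    using fin sym_adj[of E] adj_subset[OF G] irrefl_adj[OF G]
    by (auto simp: finite_crossing) (auto simp: crossing_def sym_def)
  \<comment> \<open>Half of at least 3 edges is at least 2 by integrality; the factor 2 from
    \<open>card_crossing\<close> cancels.\<close>
  have "2 \<le> card (?B \<inter> S \<times> (V - S))" if "S \<noteq> {}" "S \<subset> V" for S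
    using X[of S] cut[OF that] card_crossing[OF fin sym_adj adj_subset[OF G], of S]
      card_crossing[OF B(1-3), of S] by simp
  then obtain R where R: "R \<union> R\<inverse> = ?B" "R \<inter> R\<inverse> = {}" "V \<times> V \<subseteq> R\<^sup>*"
    using strong_orientation[OF B(1,2,4,3)] by metis
  \<comment> \<open>Color 0 marks arcs leaving \<open>X\<close>, color 1 those entering it. Each
    edge has only one orientation in \<open>R\<close>, so the color depends on the unordered pair
    alone; edges outside the bipartite subgraph get 1.\<close>
  define c :: "'a set \<Rightarrow> nat"
    where "c e = (if \<exists>x y. e = {x, y} \<and> (x, y) \<in> R \<and> x \<in> X then 0 else 1)" for e
  have cross: "x \<in> X \<longleftrightarrow> y \<notin> X" "{x, y} \<in> E" if "(x, y) \<in> R" for x y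
    using that R(1) by (auto simp: crossing_def adj_def)
  have c: "c {x, y} = (if x \<in> X then 0 else 1)" if "(x, y) \<in> R" for x y
  proof -
    have "(y, x) \<notin> R" using R(2) that by auto
    then show ?thesis using that cross by (auto simp: c_def doubleton_eq_iff)
  qed
  have "proper_connected_coloring V E c"
    unfolding proper_connected_coloring_def
  proof (intro ballI impI)
    fix u v assume uv: "u \<in> V" "v \<in> V"
    then have "(u, v) \<in> R\<^sup>*" using R by auto
    then obtain p where p: "p \<noteq> []" "hd p = u" "last p = v" "distinct p"
      "set p \<subseteq> insert u (Range R)" "successively (\<lambda>x y. (x, y) \<in> R) p"
      using rtrancl_imp_distinct_path by metis
    have arc: "(p ! i, p ! Suc i) \<in> R" if "Suc i < length p" for i
      using p(6) that by (auto simp: successively_conv_nth)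
    have "graph_path V E u p v"
      using p uv R(1) B(3) arc cross(2) by (auto simp: graph_path_def)
    moreover have "properly_colored c p"
      unfolding properly_colored_def
    proof (intro allI impI)
      fix i assume "Suc (Suc i) < length p"
      then have "(p ! i, p ! Suc i) \<in> R" "(p ! Suc i, p ! Suc (Suc i)) \<in> R"
        using arc by auto
      then show "c {p ! i, p ! Suc i} \<noteq> c {p ! Suc i, p ! Suc (Suc i)}"
        using cross(1)[of "p ! i"] by (simp add: c)
    qed
    ultimately show "\<exists>p. graph_path V E u p v \<and> properly_colored c p" by blast
  qed
  moreover have "range c \<subseteq> {0, 1}" by (auto simp: c_def)
  ultimately show ?thesis using that by blast
qed

text \<open>A path between nonadjacent vertices has at least two edges, and on a proper path the
  first two differ in color.\<close>

lemma proper_connected_coloring_two_colors: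
  assumes G: "simple_graph V E" and c: "proper_connected_coloring V E c"
    and uv: "u \<in> V" "v \<in> V" "u \<noteq> v" "{u, v} \<notin> E"
  shows "2 \<le> card (c ` E)"
proof -
  obtain p where p: "graph_path V E u p v" "properly_colored c p"
    using c uv by (auto simp: proper_connected_coloring_def)
  have "length p \<noteq> 0" "length p \<noteq> Suc 0" "length p \<noteq> Suc (Suc 0)"
    using p(1) uv by (auto simp: graph_path_def length_Suc_conv)
  then have len: "Suc (Suc 0) < length p" by linarith
  let ?e = "{p ! 0, p ! Suc 0}" and ?f = "{p ! Suc 0, p ! Suc (Suc 0)}"
  have "?e \<in> E" "?f \<in> E" using p(1) len by (auto simp: graph_path_def)
  have "c ?e \<noteq> c ?f" using p(2) len by (auto simp: properly_colored_def)
  then have "card {c ?e, c ?f} = 2" by simp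
  moreover have "card {c ?e, c ?f} \<le> card (c ` E)"
    using \<open>?e \<in> E\<close> \<open>?f \<in> E\<close> finite_edges[OF G] by (intro card_mono) auto
  ultimately show ?thesis by simp
qed

text \<open>The nonadjacent pair excludes complete graphs, where fewer colors suffice.\<close>

lemma three_edge_connected_proper_connection_number:
  assumes G: "simple_graph V E" and "V \<noteq> {}"
    and cut: "\<And>S. S \<noteq> {} \<Longrightarrow> S \<subset> V \<Longrightarrow> 3 \<le> card (adj E \<inter> S \<times> (V - S))"
    and uv: "u \<in> V" "v \<in> V" "u \<noteq> v" "{u, v} \<notin> E"
  shows "graph_connected V E" "proper_connection_number V E = 2"
proof -
  obtain c where c: "proper_connected_coloring V E c" "range c \<subseteq> {0, 1}"
    using three_edge_connected_coloring[OF G cut] by blast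
  have "\<exists>p. graph_path V E x p y" if "x \<in> V" "y \<in> V" for x y
  proof (cases "x = y")
    case True
    then show ?thesis using that by (intro exI[of _ "[x]"]) (auto simp: graph_path_def)
  next
    case False
    then show ?thesis using c(1) that by (auto simp: proper_connected_coloring_def)
  qed
  then show "graph_connected V E" using \<open>V \<noteq> {}\<close> by (auto simp: graph_connected_def)
  have "c ` E \<subseteq> {0, 1}" using c(2) by (meson image_mono subset_UNIV subset_trans)
  then have "card (c ` E) \<le> card {0, 1 :: nat}" by (intro card_mono) auto
  then have "card (c ` E) = 2"
    using proper_connected_coloring_two_colors[OF G c(1) uv] by simp
  then show "proper_connection_number V E = 2"
    unfolding proper_connection_number_def
    using c(1) proper_connected_coloring_two_colors[OF G _ uv] by (intro Least_equality) auto
qed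

subsection \<open>Switchings across a cut\<close>

lemma card_neighbours:
  assumes "simple_graph V E"
  shows "card (adj E `` {v}) = graph_degree E v"
proof -
  have "bij_betw (\<lambda>w. {v, w}) (adj E `` {v}) {e \<in> E. v \<in> e}"
    unfolding bij_betw_def
  proof
    show "inj_on (\<lambda>w. {v, w}) (adj E `` {v})"
      by (auto simp: inj_on_def doubleton_eq_iff)
    have "\<exists>w. e = {v, w}" if "e \<in> E" "v \<in> e" for e
      using that assms by (auto simp: simple_graph_def card_2_iff insert_commute)
    then show "(\<lambda>w. {v, w}) ` (adj E `` {v}) = {e \<in> E. v \<in> e}"
      by (fastforce simp: adj_def)
  qed
  then show ?thesis by (simp add: graph_degree_def bij_betw_same_card)
qed

lemma regular_graphs_iff:
  "E \<in> regular_graphs r n \<longleftrightarrow>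
     simple_graph {..<n} E \<and> (\<forall>v<n. card (adj E `` {v}) = r)"
  by (auto simp: regular_graphs_def card_neighbours)

lemma finite_regular_graphs: "finite (regular_graphs r n)"
  by (rule finite_subset[of _ "Pow (Pow {..<n})"]) (auto simp: regular_graphs_def simple_graph_def)

lemma card_adj_from:
  assumes "E \<in> regular_graphs r n" "S \<subseteq> {..<n}"
  shows "card (adj E \<inter> S \<times> {..<n}) = r * card S"
proof -
  have G: "simple_graph {..<n} E" using assms by (simp add: regular_graphs_iff)
  have "adj E \<inter> S \<times> {..<n} = Sigma S (\<lambda>v. adj E `` {v})"
    using adj_subset[OF G] by auto
  moreover have "finite S" using assms(2) finite_subset by blast
  moreover have "finite (adj E `` {v})" for v using finite_adj[OF G] by (rule finite_Image)
  ultimately have "card (adj E \<inter> S \<times> {..<n}) = (\<Sum>v\<in>S. card (adj E `` {v}))"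
    by simp
  also have "\<dots> = (\<Sum>v\<in>S. r)" using assms by (intro sum.cong) (auto simp: regular_graphs_iff)
  finally show ?thesis by simp
qed

text \<open>Counts the edge ends in \<open>S\<close>: an inner edge has two, a cut edge one.\<close>

lemma card_adj_inside:
  assumes "E \<in> regular_graphs r n" "S \<subseteq> {..<n}"
  shows "card (adj E \<inter> S \<times> S) + card (adj E \<inter> S \<times> ({..<n} - S)) = r * card S"
proof -
  have "adj E \<inter> S \<times> {..<n} = adj E \<inter> S \<times> S \<union> adj E \<inter> S \<times> ({..<n} - S)"
    using assms(2) by auto
  moreover have "finite (adj E)" using assms finite_adj[of "{..<n}" E] by (simp add: regular_graphs_iff)
  moreover have "card (adj E \<inter> S \<times> S \<union> adj E \<inter> S \<times> ({..<n} - S)) =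
      card (adj E \<inter> S \<times> S) + card (adj E \<inter> S \<times> ({..<n} - S))"
    using \<open>finite (adj E)\<close> by (intro card_Un_disjoint) auto
  ultimately show ?thesis using card_adj_from[OF assms] by simp
qed

lemma card_cut_complement:
  assumes "S \<subseteq> V"
  shows "card (adj E \<inter> (V - S) \<times> (V - (V - S))) = card (adj E \<inter> S \<times> (V - S))"
proof -
  have "adj E \<inter> (V - S) \<times> (V - (V - S)) = (adj E \<inter> S \<times> (V - S))\<inverse>"
    using assms sym_adj[of E] by (auto simp: sym_def)
  then show ?thesis by simp
qed

section \<open>The switching operation\<close>

definition switch :: "'a set set \<Rightarrow> 'a \<Rightarrow> 'a \<Rightarrow> 'a \<Rightarrow> 'a \<Rightarrow> 'a set set" where
  "switch E a b c d = E - {{a, b}, {c, d}} \<union> {{a, c}, {b, d}}"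

lemma switch_commute:
  "switch E a b c d = switch E b a d c" "switch E a b c d = switch E c d a b"
  by (auto simp: switch_def insert_commute)

text \<open>Exchanging the middle vertices undoes a switching, so the switched graph together with
  the four vertices determines the original graph.\<close>

lemma switch_switch:
  assumes "{a, b} \<in> E" "{c, d} \<in> E" "{a, c} \<notin> E" "{b, d} \<notin> E"
  shows "switch (switch E a b c d) a c b d = E"
  using assms by (auto simp: switch_def)

lemma card_neighbours_switch:
  assumes "finite (adj E)" "{a, b} \<in> E" "{c, d} \<in> E" "{a, c} \<notin> E" "{b, d} \<notin> E"
    and "a \<noteq> d" "b \<noteq> c" "a \<noteq> b" "c \<noteq> d" "a \<noteq> c" "b \<noteq> d"
  shows "card (adj (switch E a b c d) `` {v}) = card (adj E `` {v})"
proof -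
  \<comment> \<open>Each of the four vertices trades one neighbour for another. Only the first is
    computed; \<open>switch_commute\<close> brings the others into its place.\<close>
  have main: "card (adj (switch E x y z w) `` {x}) = card (adj E `` {x})"
    if "{x, y} \<in> E" "{z, w} \<in> E" "{x, z} \<notin> E"
      "x \<noteq> w" "y \<noteq> z" "x \<noteq> y" "z \<noteq> w" "x \<noteq> z" "y \<noteq> w" for x y z w
  proof -
    have "adj (switch E x y z w) `` {x} = insert z (adj E `` {x} - {y})"
      using that by (auto simp: adj_def switch_def doubleton_eq_iff)
    moreover have "finite (adj E `` {x})" using assms(1) by (rule finite_Image)
    moreover have "y \<in> adj E `` {x}" "z \<notin> adj E `` {x}" using that by (auto simp: adj_def)
    ultimately show ?thesis
      using card_Suc_Diff1[of "adj E `` {x}" y] by simp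
  qed
  consider "v = a" | "v = b" | "v = c" | "v = d" | "v \<notin> {a, b, c, d}" by blast
  then show ?thesis
  proof cases
    case 1
    then show ?thesis using main[of a b c d] assms by metis
  next
    case 2
    have "switch E b a d c = switch E a b c d" by (rule switch_commute)
    moreover have "{b, a} \<in> E" "{d, c} \<in> E" using assms by (simp_all add: insert_commute)
    ultimately show ?thesis using main[of b a d c] assms 2 by metis
  next
    case 3
    have "switch E c d a b = switch E a b c d" by (rule switch_commute)
    moreover have "{c, a} \<notin> E" using assms by (simp add: insert_commute)
    ultimately show ?thesis using main[of c d a b] assms 3 by metis
  next
    case 4
    have "switch E d c b a = switch E a b c d" by (metis switch_commute)
    moreover have "{d, c} \<in> E" "{b, a} \<in> E" "{d, b} \<notin> E"
      using assms by (simp_all add: insert_commute)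
    ultimately show ?thesis using main[of d c b a] assms 4 by metis
  next
    case 5
    then have "adj (switch E a b c d) `` {v} = adj E `` {v}"
      by (auto simp: adj_def switch_def doubleton_eq_iff)
    then show ?thesis by simp
  qed
qed

section \<open>Double counting of switchings\<close>

definition cut_graphs :: "nat \<Rightarrow> nat \<Rightarrow> nat set \<Rightarrow> nat \<Rightarrow> nat set set set" where
  "cut_graphs r n S d =
     {E \<in> regular_graphs r n. card (adj E \<inter> S \<times> ({..<n} - S)) = d}"

lemma finite_cut_graphs: "finite (cut_graphs r n S d)"
  by (simp add: cut_graphs_def finite_regular_graphs)

text \<open>The directions of the arcs fix which ends get joined. Reversing both arcs gives the same
  switching, so each is listed twice, just as \<open>cut_pairs\<close> lists both orders.\<close>

definition switchings :: "nat \<Rightarrow> nat set \<Rightarrow> nat set set \<Rightarrow> ((nat \<times> nat) \<times> nat \<times> nat) set" where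
  "switchings n S E = {((a, b), (c, d)). (a, b) \<in> adj E \<inter> S \<times> S \<and>
     (c, d) \<in> adj E \<inter> ({..<n} - S) \<times> ({..<n} - S) \<and> (a, c) \<notin> adj E \<and> (b, d) \<notin> adj E}"

definition cut_pairs :: "nat \<Rightarrow> nat set \<Rightarrow> nat set set \<Rightarrow> ((nat \<times> nat) \<times> nat \<times> nat) set" where
  "cut_pairs n S E = {((a, b), (c, d)). (a, c) \<in> adj E \<inter> S \<times> ({..<n} - S) \<and>
     (b, d) \<in> adj E \<inter> S \<times> ({..<n} - S) \<and> (a, c) \<noteq> (b, d)}"

text \<open>The removed edges lie within the two sides and the added ones run across, so the cut
  grows by exactly two.\<close>

lemma switch_cut_graphs:
  assumes E: "E \<in> cut_graphs r n S k" and S: "S \<subseteq> {..<n}"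
    and sw: "((a, b), (c, d)) \<in> switchings n S E"
  shows "switch E a b c d \<in> cut_graphs r n S (k + 2)"
    and "((a, b), (c, d)) \<in> cut_pairs n S (switch E a b c d)"
    and "switch (switch E a b c d) a c b d = E"
proof -
  have G: "simple_graph {..<n} E" and reg: "\<And>v. v < n \<Longrightarrow> card (adj E `` {v}) = r"
    and cut: "card (adj E \<inter> S \<times> ({..<n} - S)) = k"
    using E by (auto simp: cut_graphs_def regular_graphs_iff)
  have mem: "a \<in> S" "b \<in> S" "c < n" "d < n" "c \<notin> S" "d \<notin> S"
    using sw by (auto simp: switchings_def)
  have edges: "{a, b} \<in> E" "{c, d} \<in> E" "{a, c} \<notin> E" "{b, d} \<notin> E"
    using sw by (auto simp: switchings_def adj_def)
  have "a \<noteq> b" "c \<noteq> d"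
    using edges G by (auto simp: simple_graph_def)
  then have distinct: "a \<noteq> d" "b \<noteq> c" "a \<noteq> b" "c \<noteq> d" "a \<noteq> c" "b \<noteq> d"
    using mem by auto
  let ?E = "switch E a b c d"
  have "simple_graph {..<n} ?E"
    using G mem S distinct by (auto simp: simple_graph_def switch_def)
  then have "?E \<in> regular_graphs r n"
    using card_neighbours_switch[OF finite_adj[OF G] edges distinct] reg
    by (simp add: regular_graphs_iff)
  moreover have "adj ?E \<inter> S \<times> ({..<n} - S) = insert (a, c) (insert (b, d) (adj E \<inter> S \<times> ({..<n} - S)))"
    using mem by (auto simp: adj_def switch_def doubleton_eq_iff)
  moreover have "(a, c) \<notin> adj E" "(b, d) \<notin> adj E" "finite (adj E)"
    using sw finite_adj[OF G] by (auto simp: switchings_def)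
  ultimately show "?E \<in> cut_graphs r n S (k + 2)"
    using cut distinct by (simp add: cut_graphs_def)
  show "((a, b), (c, d)) \<in> cut_pairs n S ?E"
    using mem distinct by (auto simp: cut_pairs_def adj_def switch_def)
  show "switch ?E a c b d = E"
    using edges by (rule switch_switch)
qed

lemma card_cut_pairs:
  assumes "E \<in> cut_graphs r n S k"
  shows "finite (cut_pairs n S E)" "card (cut_pairs n S E) \<le> k * (k - 1)"
proof -
  let ?C = "adj E \<inter> S \<times> ({..<n} - S)"
  have C: "finite ?C" "card ?C = k"
    using assms by (auto simp: cut_graphs_def regular_graphs_iff dest: finite_adj)
  let ?P = "Sigma ?C (\<lambda>x. ?C - {x})"
  let ?f = "\<lambda>((a, c), (b, d)). ((a, b), (c, d))"
  have sub: "cut_pairs n S E \<subseteq> ?f ` ?P"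
  proof (rule subrelI)
    fix x y assume xy: "(x, y) \<in> cut_pairs n S E"
    obtain a b c d where [simp]: "x = (a, b)" "y = (c, d)" by (metis surj_pair)
    have "((a, c), (b, d)) \<in> ?P" using xy by (auto simp: cut_pairs_def)
    then have "?f ((a, c), (b, d)) \<in> ?f ` ?P" by (rule imageI)
    then show "(x, y) \<in> ?f ` ?P" by simp
  qed
  have fin: "finite ?P" using C by blast
  show "finite (cut_pairs n S E)" using sub fin finite_subset by blast
  have "card (cut_pairs n S E) \<le> card ?P"
    using sub fin by (meson card_image_le card_mono finite_imageI le_trans)
  also have "\<dots> = (\<Sum>x\<in>?C. k - 1)" using C by (subst card_SigmaI) auto
  finally show "card (cut_pairs n S E) \<le> k * (k - 1)" using C by simp
qed

text \<open>The subtracted term bounds the pairs of arcs whose switching would double an edge: each of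
  the \<open>k\<close> cut edges excludes at most \<open>r\<^sup>2\<close> pairs in each of two ways.\<close>
lemma card_switchings:
  assumes E: "E \<in> cut_graphs r n S k" and S: "S \<subseteq> {..<n}"
  shows "finite (switchings n S E)"
    and "(r * real (card S) - k) * (r * real (n - card S) - k) - 2 * real k * (real r)\<^sup>2
           \<le> card (switchings n S E)"
proof -
  let ?T = "{..<n} - S"
  let ?C = "adj E \<inter> S \<times> ?T" and ?I = "adj E \<inter> S \<times> S" and ?J = "adj E \<inter> ?T \<times> ?T"
  have R: "E \<in> regular_graphs r n" and G: "simple_graph {..<n} E" and C: "card ?C = k"
    and reg: "\<And>v. v < n \<Longrightarrow> card (adj E `` {v}) = r"
    using E by (auto simp: cut_graphs_def regular_graphs_iff)
  have fin: "finite (adj E)" by (rule finite_adj[OF G])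
  have finS: "finite S" using S finite_subset by blast
  have cards: "card ?I + k = r * card S" "card ?J + k = r * (n - card S)"
    using card_adj_inside[OF R S] card_adj_inside[OF R, of ?T] card_cut_complement[OF S, of E] C
      card_Diff_subset[OF finS S] by auto
  let ?P = "Sigma ?C (\<lambda>(a, c). adj E `` {a} \<times> adj E `` {c})"
  let ?f = "\<lambda>((a, c), (b, d)). ((a, b), (c, d))" and ?g = "\<lambda>((b, d), (a, c)). ((a, b), (c, d))"
  have "card ?P = (\<Sum>(a, c)\<in>?C. card (adj E `` {a} \<times> adj E `` {c}))"
    using fin by (subst card_SigmaI) (auto simp: case_prod_beta)
  also have "\<dots> = (\<Sum>(a, c)\<in>?C. r * r)"
    using S reg by (intro sum.cong) (auto simp: card_cartesian_product)
  also have "\<dots> = k * r\<^sup>2" using C by (simp add: power2_eq_square)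
  finally have P: "card ?P = k * r\<^sup>2" .
  have finP: "finite ?P" using fin by (intro finite_SigmaI) (auto simp: case_prod_beta)
  have sw: "switchings n S E \<subseteq> ?I \<times> ?J" by (auto simp: switchings_def)
  then show fsw: "finite (switchings n S E)" using fin finite_subset by blast
  have "?I \<times> ?J \<subseteq> switchings n S E \<union> (?f ` ?P \<union> ?g ` ?P)"
  proof (rule subrelI)
    fix x y assume xy: "(x, y) \<in> ?I \<times> ?J"
    obtain a b c d where [simp]: "x = (a, b)" "y = (c, d)" by (metis surj_pair)
    have ab: "(a, b) \<in> adj E" "(b, a) \<in> adj E" "(c, d) \<in> adj E" "(d, c) \<in> adj E"
      "a \<in> S" "b \<in> S" "c \<in> ?T" "d \<in> ?T"
      using xy sym_adj[of E] by (auto simp: sym_def)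
    consider "(a, c) \<in> adj E" | "(b, d) \<in> adj E" | "(a, c) \<notin> adj E" "(b, d) \<notin> adj E" by blast
    then show "(x, y) \<in> switchings n S E \<union> (?f ` ?P \<union> ?g ` ?P)"
    proof cases
      case 1
      then have "((a, c), (b, d)) \<in> ?P" using ab by auto
      then have "?f ((a, c), (b, d)) \<in> ?f ` ?P" by (rule imageI)
      then show ?thesis by simp
    next
      case 2
      then have "((b, d), (a, c)) \<in> ?P" using ab by auto
      then have "?g ((b, d), (a, c)) \<in> ?g ` ?P" by (rule imageI)
      then show ?thesis by simp
    next
      case 3
      then show ?thesis using ab by (auto simp: switchings_def)
    qed
  qed
  then have "card (?I \<times> ?J) \<le> card (switchings n S E \<union> (?f ` ?P \<union> ?g ` ?P))"
    using fsw finP by (intro card_mono) auto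
  also have "\<dots> \<le> card (switchings n S E) + (card (?f ` ?P) + card (?g ` ?P))"
    by (meson add_left_mono card_Un_le le_trans)
  also have "\<dots> \<le> card (switchings n S E) + (k * r\<^sup>2 + k * r\<^sup>2)"
    using card_image_le[OF finP, of ?f] card_image_le[OF finP, of ?g] P by linarith
  finally have le: "card ?I * card ?J \<le> card (switchings n S E) + 2 * (k * r\<^sup>2)"
    by (simp add: card_cartesian_product)
  have "real (card ?I) = r * real (card S) - k" "real (card ?J) = r * real (n - card S) - k"
    using cards by (simp_all flip: of_nat_mult add: cards[symmetric])
  then show "(r * real (card S) - k) * (r * real (n - card S) - k) - 2 * real k * (real r)\<^sup>2
           \<le> card (switchings n S E)"
    using of_nat_mono[OF le, where 'a = real] by simp
qed

text \<open>A graph with a switching is sent injectively to the switched graph with the same label.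
  The left factor bounds the switchings per graph from below, the right one counts ordered pairs of
  \<open>k + 2\<close> cut edges.\<close>

lemma card_cut_graphs_step:
  assumes S: "S \<subseteq> {..<n}"
  shows "card (cut_graphs r n S k) *
           ((r * real (card S) - k) * (r * real (n - card S) - k) - 2 * real k * (real r)\<^sup>2)
         \<le> card (cut_graphs r n S (k + 2)) * (real (k + 2) * real (k + 1))"
proof -
  let ?N = "cut_graphs r n S k" and ?N' = "cut_graphs r n S (k + 2)"
  let ?F = "Sigma ?N (switchings n S)" and ?B = "Sigma ?N' (cut_pairs n S)"
  let ?f = "\<lambda>(E, ((a, b), (c, d))). (switch E a b c d, ((a, b), (c, d)))"
  let ?g = "\<lambda>(E, ((a, b), (c, d))). (switch E a c b d, ((a, b), (c, d)))"
  have inv: "?g (?f x) = x" if "x \<in> ?F" for x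
    using that switch_cut_graphs(3)[OF _ S] by auto
  have "inj_on ?f ?F"
    by (rule inj_on_inverseI[of _ ?g]) (rule inv)
  moreover have "?f ` ?F \<subseteq> ?B"
    using switch_cut_graphs(1,2)[OF _ S] by auto
  moreover have "finite ?B"
    using card_cut_pairs(1) finite_cut_graphs by (intro finite_SigmaI) auto
  ultimately have le: "card ?F \<le> card ?B" by (rule card_inj_on_le)
  let ?m = "(r * real (card S) - k) * (r * real (n - card S) - k) - 2 * real k * (real r)\<^sup>2"
  have "card ?N * ?m = (\<Sum>E\<in>?N. ?m)" by simp
  also have "\<dots> \<le> (\<Sum>E\<in>?N. real (card (switchings n S E)))"
    using card_switchings(2)[OF _ S] by (intro sum_mono) auto
  also have "\<dots> = card ?F"
    using card_switchings(1)[OF _ S] finite_cut_graphs by (subst card_SigmaI) auto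
  also have "\<dots> \<le> card ?B" using le by simp
  also have "\<dots> = (\<Sum>E\<in>?N'. real (card (cut_pairs n S E)))"
    using card_cut_pairs(1) finite_cut_graphs by (subst card_SigmaI) auto
  also have "\<dots> \<le> (\<Sum>E\<in>?N'. real ((k + 2) * (k + 1)))"
    using card_cut_pairs(2)[of _ r n S "k + 2"] by (intro sum_mono of_nat_mono) auto
  also have "\<dots> = card ?N' * (real (k + 2) * real (k + 1))" by (simp add: algebra_simps)
  finally show ?thesis by (simp only: of_nat_mult of_nat_numeral)
qed

subsection \<open>Estimates for the number of graphs with a small cut\<close>

text \<open>Its left factor is that of \<open>card_cut_graphs_step\<close>, so it cancels when the
  counts are divided by binomials.\<close>

lemma binomial_add_2:
  assumes "k + 2 \<le> m"
  shows "real (m choose (k + 2)) * (real (k + 2) * real (k + 1)) =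
         real (m choose k) * (real (m - k) * (real (m - k) - 1))"
proof -
  have step: "real (Suc i) * real (m choose Suc i) = real (m - i) * real (m choose i)" for i
    using binomial_absorption[of i m] binomial_absorb_comp[of m i] by (metis of_nat_mult)
  have "real (m - Suc k) = real (m - k) - 1" using assms by simp
  then have "real (m choose (k + 2)) * (real (k + 2) * real (k + 1)) =
      real (Suc k) * real (m choose Suc k) * (real (m - k) - 1)"
    using step[of "Suc k"] by (simp add: mult_ac)
  then show ?thesis unfolding step by (simp only: mult_ac)
qed

text \<open>\<open>l\<close> is the index of the largest term of (1 + 3)^m. Comparison with its
  neighbours puts it near 3m/4, and the term is at least the average of all m + 1. For m = 3s this
  gives a target cut size near 9s/4, far enough for more than s steps of size two.\<close>

lemma binomial_mode:
  obtains l where "l \<le> m" "4 * l \<le> 3 * m + 3" "3 * m \<le> 4 * l + 1"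
    "4 ^ m \<le> (m choose l) * 3 ^ l * (m + 1)"
proof -
  let ?f = "\<lambda>i. (m choose i) * 3 ^ i"
  have "Max (?f ` {..m}) \<in> ?f ` {..m}" by (intro Max_in) auto
  then obtain l where "l \<in> {..m}" and l: "?f l = Max (?f ` {..m})" by (metis (lifting) imageE)
  then have "l \<le> m" by simp
  have max: "?f i \<le> ?f l" if "i \<le> m" for i
    unfolding l using that by (intro Max_ge) auto
  have step: "Suc i * (m choose Suc i) = (m - i) * (m choose i)" for i
    using binomial_absorption[of i m] binomial_absorb_comp[of m i] by simp
  have pos: "m choose l > 0" using \<open>l \<le> m\<close> by simp
  have "3 * (m - l) \<le> l + 1"
  proof (cases "l < m")
    case True
    then have "3 * (m choose Suc l) \<le> (m choose l)" using max[of "Suc l"] by simp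
    then have "Suc l * (3 * (m choose Suc l)) \<le> Suc l * (m choose l)" by (rule mult_le_mono2)
    then have "3 * (m - l) * (m choose l) \<le> Suc l * (m choose l)"
      using step[of l] by (simp only: mult.left_commute mult.assoc)
    then show ?thesis using pos by (simp only: mult_le_cancel2) simp
  qed simp
  moreover have "l \<le> 3 * (m - l) + 3"
  proof (cases l)
    case (Suc i)
    then have "(m choose i) \<le> 3 * (m choose l)" using max[of i] \<open>l \<le> m\<close> by simp
    then have "(m - i) * (m choose i) \<le> (m - i) * (3 * (m choose l))" by (rule mult_le_mono2)
    then have "l * (m choose l) \<le> 3 * (m - i) * (m choose l)"
      using step[of i] Suc by (simp only: mult.left_commute mult.assoc)
    then have "l \<le> 3 * (m - i)" using pos by (simp only: mult_le_cancel2)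
    then show ?thesis using Suc \<open>l \<le> m\<close> by simp
  qed simp
  moreover have "(4::nat) ^ m \<le> ?f l * (m + 1)"
  proof -
    have "(4::nat) ^ m = (3 + 1) ^ m" by simp
    also have "\<dots> = (\<Sum>i\<le>m. ?f i)" unfolding binomial_ring by simp
    also have "\<dots> \<le> (\<Sum>i\<le>m. ?f l)" using max by (intro sum_mono) auto
    also have "\<dots> = ?f l * (m + 1)" by simp
    finally show ?thesis .
  qed
  ultimately show ?thesis using that[of l] \<open>l \<le> m\<close> by simp
qed

text \<open>Comparison of \<open>(s + t choose s) x\<^sup>s\<close> with \<open>(1 + x)\<^sup>s\<^sup>+\<^sup>t\<close> at \<open>x = s / t\<close>; the bound \<open>4\<^sup>s\<close> is
  attained up to a polynomial factor at \<open>s = t\<close>.\<close>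
lemma binomial_times_ratio_le:
  assumes "s \<le> t" "t > 0"
  shows "real (s + t choose s) * (s / t) ^ s \<le> 4 ^ s"
proof -
  define p where "p = t / (s + t :: real)"
  have p: "1 / 2 \<le> p" "p \<le> 1" "0 < p" using assms by (auto simp: p_def field_simps)
  have sp: "(s + t) * (1 - p) = s" using assms by (simp add: p_def field_simps)
  \<comment> \<open>The convex function -log lies below its chord on [1/2, 1]; the weight
    \<open>2 * p - 1\<close> writes \<open>p\<close> as a combination of the end points.\<close>
  have "- log 2 ((1 - (2 * p - 1)) *\<^sub>R (1 / 2) + (2 * p - 1) *\<^sub>R 1)
      \<le> (1 - (2 * p - 1)) * - log 2 (1 / 2) + (2 * p - 1) * - log 2 1"
    using p by (intro convex_onD[OF minus_log_convex[of 2]]) auto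
  then have "- log 2 p \<le> 2 * (1 - p)"
    by (simp add: log_divide algebra_simps)
  then have "(s + t) * - log 2 p \<le> (s + t) * (2 * (1 - p))"
    by (intro mult_left_mono) auto
  also have "\<dots> = 2 * s" using sp by (simp add: algebra_simps)
  finally have "log 2 ((1 / p) ^ (s + t)) \<le> log 2 (4 ^ s)"
    using p log_pow_cancel[of 2 2] by (simp add: log_nat_power log_divide)
  then have le: "(1 / p) ^ (s + t) \<le> 4 ^ s" using p by (subst (asm) log_le_cancel_iff) auto
  have "real (s + t choose s) * (s / t) ^ s \<le> (\<Sum>k\<le>s + t. real (s + t choose k) * (s / t) ^ k)"
    by (rule member_le_sum[of s "{..s + t}" "\<lambda>k. real (s + t choose k) * (s / t) ^ k"]) auto
  also have "\<dots> = (s / t + 1) ^ (s + t)" unfolding binomial_ring by simp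
  also have "s / t + 1 = 1 / p" using assms by (simp add: p_def field_simps)
  finally show ?thesis using le by simp
qed

section \<open>Iterating the switching bound\<close>

lemma iterate_bound:
  fixes f :: "nat \<Rightarrow> real"
  assumes "\<And>j. j < k \<Longrightarrow> f j \<le> c * f (Suc j)" "c \<ge> 0"
  shows "f 0 \<le> c ^ k * f k"
  using assms(1)
proof (induction k)
  case (Suc k)
  then have "f 0 \<le> c ^ k * f k" by simp
  also have "\<dots> \<le> c ^ k * (c * f (Suc k))" using Suc.prems[of k] assms(2) by (intro mult_left_mono) auto
  finally show ?case by (simp add: mult_ac)
qed simp

lemma card_cut_graphs_le: "card (cut_graphs r n S d) \<le> card (regular_graphs r n)"
  by (intro card_mono finite_regular_graphs) (auto simp: cut_graphs_def)

text \<open>Reduces degree r to 3 at the price of 21/20. Since t is at least 504r,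
  \<open>r * t - d\<close> is at least 126r^2; also d is at most \<open>3 * (r * s - d)\<close>. So
  the subtracted term is at most 6/126 = 1/21 of the product, and 1 / (1 - 1/21) = 21/20.\<close>

lemma switch_factor_bound:
  fixes r s t d :: real
  assumes r: "3 \<le> r" and s: "0 \<le> s" "s \<le> t" and n: "1008 * r \<le> s + t" and d: "0 \<le> d" "4 * d \<le> 9 * s"
  shows "(3 * s - d) * (3 * t - d) \<le> 21 / 20 * ((r * s - d) * (r * t - d) - 2 * d * r\<^sup>2)"
proof -
  have rs: "3 * s \<le> r * s" "3 * t \<le> r * t" using r s by (auto intro: mult_right_mono)
  have "126 * r\<^sup>2 \<le> r * (t / 4)"
    using mult_left_mono[of "126 * r" "t / 4" r] n r s by (simp add: power2_eq_square mult_ac)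
  also have "\<dots> \<le> r * t - d" using rs d s by (simp add: field_simps)
  finally have rt: "126 * r\<^sup>2 \<le> r * t - d" .
  have "d \<le> 3 * (r * s - d)" using rs(1) d by (simp add: right_diff_distrib)
  then have "2 * d * r\<^sup>2 \<le> 6 * (r * s - d) * r\<^sup>2" by (intro mult_right_mono) auto
  also have "\<dots> = (r * s - d) * (126 * r\<^sup>2) / 21" by simp
  also have "\<dots> \<le> (r * s - d) * (r * t - d) / 21"
    using rt rs d s by (intro divide_right_mono mult_left_mono) auto
  finally have "2 * d * r\<^sup>2 \<le> (r * s - d) * (r * t - d) / 21" .
  moreover have "(3 * s - d) * (3 * t - d) \<le> (r * s - d) * (r * t - d)"
    using rs d s by (intro mult_mono) auto
  ultimately show ?thesis by (simp add: field_simps)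
qed

text \<open>Dividing by \<open>3s choose d\<close>, the probability that a random half of the edge ends yields a cut
  of size \<open>d\<close>, turns the switching ratios into a geometric progression.\<close>
lemma cut_graphs_step_large:
  assumes S: "S \<subseteq> {..<n}" "card S = s" and r: "3 \<le> r" and n: "1008 * r \<le> n"
    and s: "0 < s" "2 * s \<le> n" and d: "4 * d \<le> 9 * s" "d + 2 \<le> 3 * s"
  shows "card (cut_graphs r n S d) / (3 * s choose d)
       \<le> 21 / 20 * (s / (n - s)) * (card (cut_graphs r n S (d + 2)) / (3 * s choose (d + 2)))"
proof -
  define t where "t = n - s"
  have t: "s \<le> t" "n = s + t" "0 < t" using s by (auto simp: t_def)
  let ?N = "real (card (cut_graphs r n S d))" and ?N' = "real (card (cut_graphs r n S (d + 2)))"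
  let ?M = "(r * real s - d) * (r * real t - d) - 2 * real d * (real r)\<^sup>2"
  let ?C = "real (3 * s choose d)" and ?C' = "real (3 * s choose (d + 2))"
  let ?q = "real (d + 2) * real (d + 1)"
  have pos: "?C > 0" "?C' > 0" "?q > 0" using d by auto
  have N: "?N * ?M \<le> ?N' * ?q"
    using card_cut_graphs_step[OF S(1), of r d] by (simp add: S(2) t_def)
  have "(3 * real s - d) * (3 * real t - d) \<le> 21 / 20 * ?M"
    using r s t n d by (intro switch_factor_bound) auto
  \<comment> \<open>The ratio \<open>s / t\<close> arises here: as s \<le> t,
    \<open>(3 * s - d - 1) * t\<close> is at most \<open>s * (3 * t - d)\<close>.\<close>
  moreover have "real (3 * s - d) * (real (3 * s - d) - 1) * t \<le> s * ((3 * real s - d) * (3 * real t - d))"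
  proof -
    have "real d * real s \<le> real d * real t" using t by (intro mult_left_mono) auto
    moreover have "(0::real) \<le> t" by simp
    ultimately have "(3 * real s - d - 1) * t \<le> s * (3 * real t - d)"
      by (simp add: algebra_simps)
    then have "(3 * real s - d) * ((3 * real s - d - 1) * t) \<le> (3 * real s - d) * (s * (3 * real t - d))"
      using d by (intro mult_left_mono) auto
    then show ?thesis using d by (simp add: of_nat_diff mult_ac)
  qed
  ultimately have M: "real (3 * s - d) * (real (3 * s - d) - 1) * t \<le> 21 / 20 * s * ?M"
    using mult_left_mono[of "(3 * real s - d) * (3 * real t - d)" "21 / 20 * ?M" "real s"]
    by (simp add: mult_ac)
  have "?N * ?C' * t * ?q = ?N * t * (?C' * ?q)" by (simp only: mult_ac)
  also have "\<dots> = ?N * ?C * (real (3 * s - d) * (real (3 * s - d) - 1) * t)"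
    unfolding binomial_add_2[OF d(2)] by (simp only: mult_ac)
  also have "\<dots> \<le> ?N * ?C * (21 / 20 * s * ?M)" using M by (intro mult_left_mono) auto
  also have "\<dots> = 21 / 20 * s * ?C * (?N * ?M)" by (simp only: mult_ac)
  also have "\<dots> \<le> 21 / 20 * s * ?C * (?N' * ?q)" using N by (intro mult_left_mono) auto
  also have "\<dots> = 21 / 20 * s * ?C * ?N' * ?q" by (simp only: mult_ac)
  finally have "?N * ?C' * t \<le> 21 / 20 * s * ?C * ?N'" using pos(3) by (simp only: mult_le_cancel_right_pos)
  then have "?N / ?C \<le> 21 / 20 * (s / t) * (?N' / ?C')"
    using pos t by (simp add: field_simps)
  then show ?thesis using t by simp
qed

text \<open>Fourth powers clear the quarter in l \<le> (9s + 3)/4; numerically (77/25)^9 \<le>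
  (64/5)^4.\<close>

lemma power_quarter_bound:
  assumes "4 * l \<le> 9 * s + 3"
  shows "(77 / 25 :: real) ^ l \<le> 4 * (64 / 5) ^ s"
proof (rule power_le_imp_le_base)
  have "((77 / 25 :: real) ^ l) ^ Suc 3 = (77 / 25) ^ (4 * l)" by (simp flip: power_mult add: mult.commute)
  also have "\<dots> \<le> (77 / 25) ^ (9 * s + 3)" using assms by (intro power_increasing) auto
  also have "\<dots> = ((77 / 25) ^ 9) ^ s * (77 / 25) ^ 3" by (simp add: power_add power_mult)
  also have "\<dots> \<le> ((64 / 5) ^ 4) ^ s * 4 ^ 4"
    by (intro mult_mono power_mono) (auto simp: power_divide divide_simps)
  also have "\<dots> = (4 * (64 / 5) ^ s) ^ Suc 3"
    by (simp add: power_mult_distrib mult.commute flip: power_mult)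
  finally show "((77 / 25 :: real) ^ l) ^ Suc 3 \<le> (4 * (64 / 5) ^ s) ^ Suc 3" .
qed simp

text \<open>The chain climbs from \<open>d\<close> to about 9s/4 in at least s + 1 steps, each
  gaining 21/20 * s/t. The power (s/t)^s offsets \<open>n choose s\<close> up to 4^s, one more s/t
  yields 1/n, and the remaining exponentials combine to (4/5)^s.\<close>

lemma cut_graphs_large:
  assumes S: "S \<subseteq> {..<n}" "card S = s" and r: "3 \<le> r" and n: "1008 * r \<le> n"
    and s: "24 \<le> s" "2 * s \<le> n" and d: "d \<le> 2"
  shows "real (n choose s) * card (cut_graphs r n S d)
       \<le> 288 * real s ^ 4 * (4 / 5) ^ s / n * card (regular_graphs r n)"
proof -
  define t where "t = n - s"
  have t: "s \<le> t" "n = s + t" "0 < t" using s by (auto simp: t_def)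
  obtain l where l: "l \<le> 3 * s" "4 * l \<le> 3 * (3 * s) + 3" "3 * (3 * s) \<le> 4 * l + 1"
    "4 ^ (3 * s) \<le> (3 * s choose l) * 3 ^ l * (3 * s + 1)"
    using binomial_mode[of "3 * s"] by blast
  \<comment> \<open>Steps have size two, so for unequal parities the chain ends at
    \<open>l - 1\<close>. The bound s \<ge> 24 ensures k \<ge> s + 1.\<close>
  define k where "k = (l - d) div 2"
  define e where "e = d + 2 * k"
  have e: "e = l \<or> Suc e = l" and k: "s + 1 \<le> k" "2 * k \<le> l"
    using l d s by (auto simp: e_def k_def)
  let ?R = "real (card (regular_graphs r n))" and ?N = "\<lambda>i. real (card (cut_graphs r n S i))"
  let ?C = "\<lambda>i. real (3 * s choose i)"
  let ?f = "\<lambda>j. ?N (d + 2 * j) / ?C (d + 2 * j)"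
  have "?f 0 \<le> (21 / 20 * (s / t)) ^ k * ?f k"
  proof (rule iterate_bound)
    fix j assume "j < k"
    then have "2 * j + 2 \<le> 2 * k" by simp
    then have "4 * (d + 2 * j) \<le> 9 * s" "d + 2 * j + 2 \<le> 3 * s"
      using l(1,2) e unfolding e_def by auto
    then show "?f j \<le> 21 / 20 * (s / t) * ?f (Suc j)"
      using cut_graphs_step_large[OF S r n _ s(2), of "d + 2 * j"] s t by simp
  qed simp
  then have chain: "?N d / ?C d \<le> (21 / 20) ^ k * (s / t) ^ k * (?N e / ?C e)"
    unfolding power_mult_distrib[of "21 / 20"] by (simp add: e_def)
  have Cd: "0 < ?C d" "?C d \<le> 9 * real s ^ 2"
  proof -
    show "0 < ?C d" using d s by simp
    have "3 * s choose d \<le> (3 * s) ^ d" using d s by (intro binomial_le_pow) auto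
    also have "\<dots> \<le> (3 * s) ^ 2" using d s by (intro power_increasing) auto
    finally have "real (3 * s choose d) \<le> real ((3 * s) ^ 2)" by (simp only: of_nat_le_iff)
    then show "?C d \<le> 9 * real s ^ 2" by (simp add: power_mult_distrib)
  qed
  \<comment> \<open>Past the middle of \<open>3 * s\<close> the binomials decrease, so ending at
    \<open>l - 1\<close> loses nothing.\<close>
  have Ce: "(3 * s choose l) \<le> (3 * s choose e)"
    using e
  proof
    assume e: "Suc e = l"
    have "l * (3 * s choose l) = (3 * s - e) * (3 * s choose e)"
      using binomial_absorption[of e "3 * s"] binomial_absorb_comp[of "3 * s" e] e by simp
    also have "\<dots> \<le> l * (3 * s choose e)" using l e s by (intro mult_le_mono1) auto
    finally show ?thesis using e by simp
  qed simp
  have "(4::real) ^ (3 * s) \<le> ?C l * 3 ^ l * real (3 * s + 1)"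
    using of_nat_mono[OF l(4), where 'a = real]
    by (simp only: of_nat_mult of_nat_power of_nat_numeral)
  also have "\<dots> \<le> ?C e * 3 ^ l * (4 * real s)"
    using Ce s by (intro mult_mono) auto
  finally have Ce': "64 ^ s \<le> ?C e * 3 ^ l * (4 * real s)" by (simp add: power_mult)
  then have Ce_pos: "?C e > 0"
    by (smt (verit) mult_eq_0_iff of_nat_0_le_iff zero_less_power)
  have Ne: "?N e / ?C e \<le> ?R * (3 ^ l * (4 * real s) / 64 ^ s)"
  proof -
    have "1 / ?C e \<le> 3 ^ l * (4 * real s) / 64 ^ s" using Ce' Ce_pos by (simp add: field_simps)
    then have "?N e * (1 / ?C e) \<le> ?R * (3 ^ l * (4 * real s) / 64 ^ s)"
      using card_cut_graphs_le by (intro mult_mono) auto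
    then show ?thesis by simp
  qed
  have pow: "(21 / 20) ^ k * 3 ^ l \<le> 4 * (64 / 5 :: real) ^ s"
  proof -
    \<comment> \<open>Since 21/20 \<le> (77/75)^2 and 2k \<le> l, this power merges with 3^l into
      (77/25)^l.\<close>
    have "(21 / 20 :: real) ^ k \<le> ((77 / 75) ^ 2) ^ k" by (intro power_mono) (auto simp: power2_eq_square)
    also have "\<dots> = (77 / 75) ^ (2 * k)" by (simp add: power_mult)
    also have "\<dots> \<le> (77 / 75) ^ l" using k by (intro power_increasing) auto
    finally have "(21 / 20) ^ k * 3 ^ l \<le> (77 / 75 :: real) ^ l * 3 ^ l" by (intro mult_right_mono) auto
    also have "\<dots> = (77 / 25) ^ l" by (simp flip: power_mult_distrib)
    finally show ?thesis using power_quarter_bound[of l s] l(2) by simp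
  qed
  have ratio: "real (n choose s) * (s / t) ^ k \<le> 4 ^ s * (2 * s / n)"
  proof -
    have "(s / t) ^ k \<le> (s / t :: real) ^ (s + 1)" using t k by (intro power_decreasing) auto
    then have "real (n choose s) * (s / t) ^ k \<le> real (n choose s) * (s / t) ^ (s + 1)"
      by (rule mult_left_mono) simp
    also have "\<dots> = real (s + t choose s) * (s / t) ^ s * (s / t)" using t(2) by simp
    also have "\<dots> \<le> 4 ^ s * (s / t)"
      using binomial_times_ratio_le[OF t(1,3)] by (intro mult_right_mono) auto
    also have "\<dots> \<le> 4 ^ s * (2 * s / n)" using t s by (intro mult_left_mono) (auto simp: field_simps)
    finally show ?thesis .
  qed
  have "real (n choose s) * ?N d = real (n choose s) * ?C d * (?N d / ?C d)" using Cd by simp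
  also have "\<dots> \<le> real (n choose s) * ?C d * ((21 / 20) ^ k * (s / t) ^ k * (?R * (3 ^ l * (4 * real s) / 64 ^ s)))"
    using chain Ne by (intro mult_left_mono order.trans[OF chain]) auto
  also have "\<dots> = ?C d * (real (n choose s) * (s / t) ^ k) * ((21 / 20) ^ k * 3 ^ l) * (4 * real s) / 64 ^ s * ?R"
    by (simp add: mult_ac)
  \<comment> \<open>Here 4 * (64/5) / 64 = 4/5 is the geometric rate and 9 * 2 * 4 * 4 =
    288.\<close>
  also have "\<dots> \<le> (9 * real s ^ 2) * (4 ^ s * (2 * s / n)) * (4 * (64 / 5) ^ s) * (4 * real s) / 64 ^ s * ?R"
    by (intro mult_right_mono[OF divide_right_mono[OF mult_right_mono[OF
          mult_mono[OF mult_mono[OF Cd(2) ratio] pow]]]]) auto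
  also have "\<dots> = 288 * real s ^ 4 * (4 / 5) ^ s / n * ?R"
    by (simp add: power_divide power_mult_distrib power4_eq_xxxx power2_eq_square mult_ac)
  finally show ?thesis .
qed

text \<open>For bounded s each of s + 1 steps gains a factor of order 1/n. The first s of them pay
  for \<open>n choose s\<close>, and one remains.\<close>

lemma cut_graphs_small:
  assumes S: "S \<subseteq> {..<n}" "card S = s" and r: "3 \<le> r" and n: "100 * r\<^sup>2 \<le> n"
    and s: "4 \<le> s" "s < 24" and d: "d \<le> 2"
  shows "real (n choose s) * card (cut_graphs r n S d) \<le> 2704 ^ 24 / n * card (regular_graphs r n)"
proof -
  have "(3::nat) ^ 2 \<le> r\<^sup>2" using r by (intro power_mono) auto
  then have n900: "900 \<le> n" using n by simp
  have nr: "100 * (real r)\<^sup>2 \<le> n"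
    using n by (metis of_nat_le_iff of_nat_mult of_nat_numeral of_nat_power)
  let ?N = "\<lambda>i. real (card (cut_graphs r n S i))"
  have "?N (d + 2 * 0) \<le> (2704 / n) ^ (s + 1) * ?N (d + 2 * (s + 1))"
  proof (rule iterate_bound)
    fix j assume "j < s + 1"
    define e where "e = d + 2 * j"
    \<comment> \<open>From j \<le> s \<le> 23 comes 48. The second bound, 2s + 4 \<le> 3s, is where
      s \<ge> 4 enters.\<close>
    have e: "e \<le> 48" "e + 2 \<le> 3 * s" using \<open>j < s + 1\<close> d s by (auto simp: e_def)
    let ?M = "(r * real s - e) * (r * real (n - s) - e) - 2 * real e * (real r)\<^sup>2"
    have "3 * real s \<le> r * real s" "3 * real (n - s) \<le> r * real (n - s)"
      using r by (auto intro: mult_right_mono)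
    moreover have "real (n - s) = real n - real s" using s n900 by simp
    \<comment> \<open>117 = 3 * 23 + 48.\<close>
    ultimately have "2 \<le> r * real s - e" "3 * real n - 117 \<le> r * real (n - s) - e"
      using e s by linarith+
    then have "2 * (3 * real n - 117) \<le> (r * real s - e) * (r * real (n - s) - e)"
      using n900 by (intro mult_mono) linarith+
    moreover have "2 * real e * (real r)\<^sup>2 \<le> 96 * (real r)\<^sup>2"
      using e by (intro mult_right_mono) auto
    ultimately have "2 * (3 * real n - 117) - 96 * (real r)\<^sup>2 \<le> ?M" by (rule diff_mono)
    moreover have "real n \<le> 2 * (3 * real n - 117) - 96 * (real r)\<^sup>2"
      using nr n900 by simp
    ultimately have M: "n \<le> ?M" by (rule order.trans[rotated])
    have "n * ?N e \<le> ?M * ?N e" using M by (rule mult_right_mono) simp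
    also have "\<dots> = ?N e * ?M" by (rule mult.commute)
    also have "\<dots> \<le> ?N (e + 2) * (real (e + 2) * real (e + 1))"
      using card_cut_graphs_step[OF S(1), of r e] S(2) by simp
    also have "\<dots> \<le> ?N (e + 2) * (52 * 52)"
      using e by (intro mult_left_mono mult_mono) auto
    finally have "?N e \<le> 2704 / n * ?N (e + 2)" using n900 by (simp add: field_simps)
    then show "?N (d + 2 * j) \<le> 2704 / n * ?N (d + 2 * Suc j)" by (simp add: e_def)
  qed simp
  also have "\<dots> \<le> (2704 / n) ^ (s + 1) * card (regular_graphs r n)"
    using card_cut_graphs_le by (intro mult_left_mono) auto
  finally have N: "?N d \<le> (2704 / n) ^ (s + 1) * card (regular_graphs r n)" by simp
  have "n choose s \<le> n ^ s" using s n900 by (intro binomial_le_pow) auto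
  then have "real (n choose s) \<le> real n ^ s" by (metis of_nat_le_iff of_nat_power)
  then have "real (n choose s) * ?N d \<le> n ^ s * ((2704 / n) ^ (s + 1) * card (regular_graphs r n))"
    using N by (intro mult_mono) auto
  also have "\<dots> = 2704 ^ (s + 1) / n * card (regular_graphs r n)"
    using n900 by (simp add: power_divide)
  also have "\<dots> \<le> 2704 ^ 24 / n * card (regular_graphs r n)"
    using s by (intro mult_right_mono divide_right_mono power_increasing) auto
  finally show ?thesis .
qed

text \<open>With s = \<open>card S\<close>, at most s(s - 1) arcs run inside \<open>S\<close>, which
  leaves at least s(4 - s) \<ge> 3 for the cut when s is 1, 2 or 3.\<close>

lemma small_set_cut:
  assumes E: "E \<in> regular_graphs r n" and S: "S \<subseteq> {..<n}" "S \<noteq> {}" "card S \<le> 3" and r: "3 \<le> r"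
  shows "3 \<le> card (adj E \<inter> S \<times> ({..<n} - S))"
proof -
  have fin: "finite S" using S finite_subset by blast
  have G: "simple_graph {..<n} E" using E by (simp add: regular_graphs_iff)
  have "adj E \<inter> S \<times> S \<subseteq> Sigma S (\<lambda>x. S - {x})" using irrefl_adj[OF G] by auto
  then have "card (adj E \<inter> S \<times> S) \<le> card (Sigma S (\<lambda>x. S - {x}))"
    using fin by (intro card_mono) auto
  also have "\<dots> = card S * (card S - 1)" using fin by simp
  finally have "r * card S \<le> card S * (card S - 1) + card (adj E \<inter> S \<times> ({..<n} - S))"
    using card_adj_inside[OF E S(1)] by linarith
  moreover have "3 * card S \<le> r * card S" using r by simp
  moreover have "card S \<in> {1, 2, 3}" using S fin by (auto simp: le_Suc_eq numeral_eq_Suc)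
  ultimately show ?thesis by auto
qed

section \<open>Union bound over all cuts\<close>

lemma summable_power4_geometric: "summable (\<lambda>s. real s ^ 4 * (4 / 5) ^ s)"
proof (rule summable_ratio_test[of "9 / 10" 40])
  fix s :: nat assume s: "40 \<le> s"
  \<comment> \<open>(41/40)^4 \<le> 9/8, and 9/8 * 4/5 = 9/10.\<close>
  have "real (Suc s) ^ 4 \<le> (41 / 40 * s) ^ 4" using s by (intro power_mono) auto
  also have "\<dots> \<le> 9 / 8 * real s ^ 4" by (simp add: power_mult_distrib power_divide)
  finally have "real (Suc s) ^ 4 * (4 / 5) ^ Suc s \<le> 9 / 8 * real s ^ 4 * (4 / 5) ^ Suc s"
    by (intro mult_right_mono) auto
  then show "norm (real (Suc s) ^ 4 * (4 / 5) ^ Suc s) \<le> 9 / 10 * norm (real s ^ 4 * (4 / 5) ^ s)"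
    by simp
qed simp

definition small_cut_graphs :: "nat \<Rightarrow> nat \<Rightarrow> nat set set set" where
  "small_cut_graphs r n = {E \<in> regular_graphs r n.
     \<exists>S. S \<noteq> {} \<and> S \<subset> {..<n} \<and> card (adj E \<inter> S \<times> ({..<n} - S)) < 3}"

text \<open>A set and its complement have the same cut, so the smaller side can be taken;
  \<open>small_set_cut\<close> forces it to have at least 4 vertices.\<close>

lemma small_cut_graphs_subset:
  assumes "3 \<le> r"
  shows "small_cut_graphs r n \<subseteq>
    (\<Union>s\<in>{4..n div 2}. \<Union>S\<in>{S. S \<subseteq> {..<n} \<and> card S = s}. \<Union>d\<in>{..2}. cut_graphs r n S d)"
proof
  fix E assume "E \<in> small_cut_graphs r n"
  then obtain S where E: "E \<in> regular_graphs r n" and S: "S \<noteq> {}" "S \<subset> {..<n}"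
    and cut: "card (adj E \<inter> S \<times> ({..<n} - S)) < 3"
    by (auto simp: small_cut_graphs_def)
  define T where "T = (if 2 * card S \<le> n then S else {..<n} - S)"
  have fin: "finite S" using S finite_subset by blast
  have T: "T \<subseteq> {..<n}" "T \<noteq> {}" using S by (auto simp: T_def)
  have "card S + card ({..<n} - S) = n"
    using S fin card_mono[of "{..<n}" S] by (simp add: card_Diff_subset psubset_imp_subset)
  then have card: "2 * card T \<le> n" by (auto simp: T_def)
  have cutT: "card (adj E \<inter> T \<times> ({..<n} - T)) < 3"
    using cut card_cut_complement[of S "{..<n}" E] S by (auto simp: T_def)
  then have "\<not> card T \<le> 3"
    using small_set_cut[OF E T _ assms] by auto
  then have "card T \<in> {4..n div 2}" using card by auto
  moreover have "E \<in> cut_graphs r n T (card (adj E \<inter> T \<times> ({..<n} - T)))"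
    using E by (simp add: cut_graphs_def)
  moreover have "card (adj E \<inter> T \<times> ({..<n} - T)) \<in> {..2}" using cutT by simp
  ultimately show "E \<in> (\<Union>s\<in>{4..n div 2}. \<Union>S\<in>{S. S \<subseteq> {..<n} \<and> card S = s}. \<Union>d\<in>{..2}. cut_graphs r n S d)"
    using T(1) by (intro UN_I[of "card T"] UN_I[of T] UN_I) auto
qed

text \<open>The earlier bounds carry the factor \<open>n choose s\<close>, which cancels the number
  of sets of size s. Three values of d and a summable majorant \<open>h\<close> then give K =
  \<open>3 * suminf h\<close>.\<close>

lemma card_small_cut_graphs:
  assumes r: "3 \<le> r"
  obtains K where "\<And>n. 1008 * r \<le> n \<Longrightarrow> 100 * r\<^sup>2 \<le> n \<Longrightarrow>
    card (small_cut_graphs r n) \<le> K / n * card (regular_graphs r n)"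
proof -
  define h :: "nat \<Rightarrow> real"
    where "h s = (if s < 24 then 2704 ^ 24 else 288 * (real s ^ 4 * (4 / 5) ^ s))" for s
  have h0: "h s \<ge> 0" for s by (simp add: h_def)
  have "summable (\<lambda>s. 288 * (real s ^ 4 * (4 / 5) ^ s))"
    by (intro summable_mult summable_power4_geometric)
  moreover have "eventually (\<lambda>s. h s = 288 * (real s ^ 4 * (4 / 5) ^ s)) sequentially"
    using eventually_ge_at_top[of 24] by eventually_elim (simp add: h_def)
  ultimately have sum: "summable h" using summable_cong by fast
  have "card (small_cut_graphs r n) \<le> 3 * suminf h / n * card (regular_graphs r n)"
    if n: "1008 * r \<le> n" "100 * r\<^sup>2 \<le> n" for n
  proof -
    let ?R = "real (card (regular_graphs r n))"
    let ?P = "\<lambda>s. {S. S \<subseteq> {..<n} \<and> card S = s}"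
    have finP: "finite (?P s)" for s by (rule finite_subset[of _ "Pow {..<n}"]) auto
    have cardP: "card (?P s) = n choose s" for s using n_subsets[of "{..<n}" s] by simp
    have bound: "(\<Sum>S\<in>?P s. \<Sum>d\<le>2. real (card (cut_graphs r n S d))) \<le> 3 * (h s / n * ?R)"
      if s: "s \<in> {4..n div 2}" for s
    proof -
      have c: "real (n choose s) > 0" using s by auto
      have "real (card (cut_graphs r n S d)) \<le> h s / n * ?R / (n choose s)"
        if "S \<in> ?P s" "d \<le> 2" for S d
      proof -
        have "real (n choose s) * card (cut_graphs r n S d) \<le> h s / n * ?R"
          using that s n r cut_graphs_small[of S n s r d] cut_graphs_large[of S n s r d]
          by (cases "s < 24") (auto simp: h_def mult.assoc)
        then show ?thesis using c by (subst pos_le_divide_eq) (simp_all only: mult.commute)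
      qed
      then have "(\<Sum>S\<in>?P s. \<Sum>d\<le>2. real (card (cut_graphs r n S d)))
          \<le> (\<Sum>S\<in>?P s. \<Sum>d\<le>(2::nat). h s / n * ?R / (n choose s))"
        by (intro sum_mono) auto
      also have "\<dots> = 3 * (h s / n * ?R)" using c cardP by simp
      finally show ?thesis .
    qed
    have "card (small_cut_graphs r n) \<le> card (\<Union>s\<in>{4..n div 2}. \<Union>S\<in>?P s. \<Union>d\<in>{..2}. cut_graphs r n S d)"
      using finP finite_cut_graphs by (intro card_mono[OF _ small_cut_graphs_subset[OF r]]) auto
    also have "\<dots> \<le> (\<Sum>s\<in>{4..n div 2}. card (\<Union>S\<in>?P s. \<Union>d\<in>{..2}. cut_graphs r n S d))"
      by (rule card_UN_le) simp
    also have "\<dots> \<le> (\<Sum>s\<in>{4..n div 2}. \<Sum>S\<in>?P s. card (\<Union>d\<in>{..2}. cut_graphs r n S d))"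
      using finP by (intro sum_mono card_UN_le)
    also have "\<dots> \<le> (\<Sum>s\<in>{4..n div 2}. \<Sum>S\<in>?P s. \<Sum>d\<le>2. card (cut_graphs r n S d))"
      by (intro sum_mono card_UN_le) simp
    finally have "real (card (small_cut_graphs r n))
        \<le> real (\<Sum>s\<in>{4..n div 2}. \<Sum>S\<in>?P s. \<Sum>d\<le>2. card (cut_graphs r n S d))"
      by (simp only: of_nat_le_iff)
    also have "\<dots> \<le> (\<Sum>s\<in>{4..n div 2}. 3 * (h s / n * ?R))"
      unfolding of_nat_sum by (intro sum_mono bound)
    also have "\<dots> = sum h {4..n div 2} * (3 / n * ?R)"
      by (subst sum_distrib_right) (simp add: mult_ac)
    also have "\<dots> \<le> suminf h * (3 / n * ?R)"
      using sum h0 by (intro mult_right_mono sum_le_suminf) auto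
    finally show ?thesis by (simp add: mult_ac)
  qed
  then show ?thesis using that by blast
qed

section \<open>Conclusion for almost all regular graphs\<close>

lemma regular_graph_proper_connection_number:
  assumes E: "E \<in> regular_graphs r n - small_cut_graphs r n" and n: "r + 2 \<le> n"
  shows "graph_connected {..<n} E" "proper_connection_number {..<n} E = 2"
proof -
  have G: "simple_graph {..<n} E" using E by (simp add: regular_graphs_iff)
  \<comment> \<open>Vertex 0 and its \<open>r\<close> neighbours do not exhaust \<open>n\<close>
    vertices, which yields a nonadjacent pair.\<close>
  have "card (insert 0 (adj E `` {0})) \<le> Suc (card (adj E `` {0}))"
    by (rule card_insert_le_m1) auto
  moreover have "card (adj E `` {0}) = r" using E n by (simp add: regular_graphs_iff)
  ultimately have "card (insert 0 (adj E `` {0})) < card {..<n}" using n by simp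
  then obtain v where v: "v < n" "v \<noteq> 0" "(0, v) \<notin> adj E"
    using card_mono[of "insert 0 (adj E `` {0})" "{..<n}"] finite_Image[OF finite_adj[OF G]]
    by (metis Image_singleton_iff finite_insert insertCI leD lessThan_iff subsetI)
  have cut: "3 \<le> card (adj E \<inter> S \<times> ({..<n} - S))" if "S \<noteq> {}" "S \<subset> {..<n}" for S
    using E that by (auto simp: small_cut_graphs_def not_less)
  note res = three_edge_connected_proper_connection_number[OF G _ cut, of 0 v]
  show "graph_connected {..<n} E" "proper_connection_number {..<n} E = 2"
    using res v n by (auto simp: adj_def)
qed

theorem theorem1p7:
  fixes r :: nat
  assumes "r \<ge> 3"
  shows "((\<lambda>n. real (card {E \<in> regular_graphs r n.
                  graph_connected {..<n} E \<and> proper_connection_number {..<n} E = 2})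
              / real (card (regular_graphs r n))) \<longlongrightarrow> 1)
           (inf sequentially (principal {n. regular_graphs r n \<noteq> {}}))"
proof -
  let ?R = "regular_graphs r"
  let ?G = "\<lambda>n. {E \<in> ?R n. graph_connected {..<n} E \<and> proper_connection_number {..<n} E = 2}"
  let ?F = "inf sequentially (principal {n. ?R n \<noteq> {}})"
  obtain K where K: "\<And>n. 1008 * r \<le> n \<Longrightarrow> 100 * r\<^sup>2 \<le> n \<Longrightarrow>
      card (small_cut_graphs r n) \<le> K / n * card (?R n)"
    using card_small_cut_graphs[OF assms] by metis
  have lower: "1 - K / n \<le> card (?G n) / card (?R n)"
    if n: "1008 * r \<le> n" "100 * r\<^sup>2 \<le> n" and ne: "?R n \<noteq> {}" for n
  proof -
    have R: "real (card (?R n)) > 0" using ne finite_regular_graphs by (simp add: card_gt_0_iff)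
    have "?R n - small_cut_graphs r n \<subseteq> ?G n"
      using regular_graph_proper_connection_number n(1) assms by auto
    then have "card (?R n - small_cut_graphs r n) \<le> card (?G n)"
      using finite_regular_graphs by (intro card_mono) auto
    moreover have "card (?R n) - card (small_cut_graphs r n) \<le> card (?R n - small_cut_graphs r n)"
      by (intro diff_card_le_card_Diff finite_subset[OF _ finite_regular_graphs])
        (auto simp: small_cut_graphs_def)
    ultimately have "real (card (?R n)) \<le> card (?G n) + card (small_cut_graphs r n)"
      by linarith
    also have "\<dots> \<le> card (?G n) + K / n * card (?R n)" using K[OF n] by simp
    finally have "(1 - K / n) * card (?R n) \<le> card (?G n)" by (simp add: algebra_simps)
    then show ?thesis using R by (simp add: pos_le_divide_eq)
  qed
  have "eventually (\<lambda>n. 1 - K / n \<le> card (?G n) / card (?R n)) ?F"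
    unfolding eventually_inf_principal
    using eventually_ge_at_top[of "1008 * r"] eventually_ge_at_top[of "100 * r\<^sup>2"]
    by eventually_elim (use lower in blast)
  moreover have "eventually (\<lambda>n. card (?G n) / card (?R n) \<le> (1::real)) ?F"
  proof (intro always_eventually allI)
    fix n
    have "card (?G n) \<le> card (?R n)" by (intro card_mono finite_regular_graphs) auto
    \<comment> \<open>If there are no graphs, the quotient is 0 by the convention for division by
      zero.\<close>
    then show "card (?G n) / card (?R n) \<le> (1::real)" by (cases "card (?R n) = 0") simp_all
  qed
  moreover have "((\<lambda>n. 1 - K / real n) \<longlongrightarrow> 1 - 0) ?F"
    by (intro tendsto_mono[OF inf_le1] tendsto_diff tendsto_const lim_const_over_n)
  ultimately show ?thesis
    using tendsto_sandwich[of "\<lambda>n. 1 - K / real n" _ ?F "\<lambda>_. 1" 1] by simp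
qed

end
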